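(* Let $a,b,m,n$ be positive integers and let $R_1=\langle r_1,\ldots,r_a\rangle$, $R_2=\langle r'_1,\ldots,r'_m\rangle$, $R_3=\langle r''_1,\ldots,r''_m\rangle$, $S_1=\langle s_1,\ldots,s_b\rangle$, $S_2=\langle s'_1,\ldots,s'_n\rangle$, $S_3=\langle s''_1,\ldots,s''_n\rangle$ be vectors of nonnegative integers. Let $u=r_1+\cdots+r_a$, $u'=r'_1+\cdots+r'_m$, $u''=r''_1+\cdots+r''_m$, and suppose $u'\neq u''$. If $\mathcal{D}_1,\mathcal{D}_2,\mathcal{D}_3$ are antichains in the Bruhat orders of $\mathcal{A}(R_1,S_1)$, $\mathcal{A}(R_2,S_2)$, $\mathcal{A}(R_3,S_3)$ respectively, then there is an antichain of size $|\mathcal{D}_1|\,|\mathcal{D}_2|^{u}\,|\mathcal{D}_3|^{ab-u}$ in the Bruhat order of the class $\mathcal{A}(R,S)$, where $R=R_1\otimes R_2+(b-R_1)\otimes R_3$ and $S=S_1\otimes S_2+(a-S_1)\otimes S_3$.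
   Context: For vectors $R=\langle r_1,\ldots,r_p\rangle$, $S=\langle s_1,\ldots,s_q\rangle$ of nonnegative integers, $\mathcal{A}(R,S)$ is the class of all $p\times q$ matrices with entries in $\{0,1\}$ whose $i$-th row sums to $r_i$ and $j$-th column sums to $s_j$. For a $(0,1)$-matrix $A=[a_{ij}]$ let $\sigma_{ij}(A)=\sum_{k=1}^{i}\sum_{\ell=1}^{j}a_{k\ell}$; for $A,C$ in the same class, $A\preceq_B C$ (Bruhat order) iff $\sigma_{ij}(A)\geqslant\sigma_{ij}(C)$ for all $i,j$. An antichain is a set of pairwise incomparable elements. For vectors $U=\langle u_1,\ldots,u_p\rangle$ and $V=\langle v_1,\ldots,v_q\rangle$, the Kronecker product $U\otimes V$ is the vector of length $pq$ whose entry in position $(i-1)q+k$ is $u_iv_k$. For a constant $t$, $t-U$ denotes $\langle t-u_1,\ldots,t-u_p\rangle$. *)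

theory Defs
  imports "Jordan_Normal_Form.Matrix"
begin

text \<open>
  Vectors and matrices are indexed from 0. Integer entries are used so that the subtraction in
  \<open>const_minus_vec\<close> is not truncated; nonnegativity of the margins is stated where it is assumed.
\<close>

definition margin_class :: "int vec \<Rightarrow> int vec \<Rightarrow> int mat set" where
  "margin_class R S = {A \<in> carrier_mat (dim_vec R) (dim_vec S).
     (\<forall>i<dim_vec R. \<forall>j<dim_vec S. A $$ (i, j) \<in> {0, 1}) \<and>
     (\<forall>i<dim_vec R. (\<Sum>j<dim_vec S. A $$ (i, j)) = R $ i) \<and>
     (\<forall>j<dim_vec S. (\<Sum>i<dim_vec R. A $$ (i, j)) = S $ j)}"

text \<open>The arguments \<open>i\<close> and \<open>j\<close> count rows and columns, so they range over
  \<open>{1..dim_row A}\<close> and \<open>{1..dim_col A}\<close> despite the 0-based matrix indices.\<close>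

definition corner_sum :: "int mat \<Rightarrow> nat \<Rightarrow> nat \<Rightarrow> int" where
  "corner_sum A i j = (\<Sum>k<i. \<Sum>l<j. A $$ (k, l))"

text \<open>Meaningful for two matrices of the same class; note the reversed inequality.\<close>

definition bruhat_le :: "int mat \<Rightarrow> int mat \<Rightarrow> bool" where
  "bruhat_le A C \<longleftrightarrow>
     (\<forall>i\<in>{1..dim_row A}. \<forall>j\<in>{1..dim_col A}. corner_sum A i j \<ge> corner_sum C i j)"

definition bruhat_antichain :: "int vec \<Rightarrow> int vec \<Rightarrow> int mat set \<Rightarrow> bool" where
  "bruhat_antichain R S D \<longleftrightarrow> D \<subseteq> margin_class R S \<and>
     (\<forall>A\<in>D. \<forall>C\<in>D. A \<noteq> C \<longrightarrow> \<not> bruhat_le A C \<and> \<not> bruhat_le C A)"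

definition kron_vec :: "int vec \<Rightarrow> int vec \<Rightarrow> int vec" where
  "kron_vec U V = vec (dim_vec U * dim_vec V)
     (\<lambda>k. U $ (k div dim_vec V) * V $ (k mod dim_vec V))"

definition const_minus_vec :: "int \<Rightarrow> int vec \<Rightarrow> int vec" where
  "const_minus_vec t U = vec (dim_vec U) (\<lambda>i. t - U $ i)"

end

theory Submission
  imports Defs
begin

text \<open>
  Replace every 1 of a matrix from \<open>D1\<close> by some matrix from \<open>D2\<close> and every 0 by some matrix from
  \<open>D3\<close>. At block corners, the corner sums of the result are an affine function of the corner sums of
  the outer matrix, with slope \<open>u' - u'' \<noteq> 0\<close>; hence different outer matrices give incomparable
  results. If the outer matrices agree, then inside block \<open>(i, j)\<close> all contributions of the other
  blocks to a corner sum are determined by the margins, so the results compare in that block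
  exactly as the blocks themselves do.
\<close>

section \<open>Block matrices and their corner sums\<close>

definition block_mat :: "nat \<Rightarrow> nat \<Rightarrow> nat \<Rightarrow> nat \<Rightarrow> (nat \<times> nat \<Rightarrow> int mat) \<Rightarrow> int mat" where
  "block_mat a b m n B =
     mat (a * m) (b * n) (\<lambda>(x, y). B (x div m, y div n) $$ (x mod m, y mod n))"

lemma dim_block_mat [simp]:
  "dim_row (block_mat a b m n B) = a * m" "dim_col (block_mat a b m n B) = b * n"
  by (simp_all add: block_mat_def)

lemma block_mat_index:
  assumes "k < m" "l < n" "i * m + k < a * m" "j * n + l < b * n"
  shows "block_mat a b m n B $$ (i * m + k, j * n + l) = B (i, j) $$ (k, l)"
  using assms by (simp add: block_mat_def)

lemma mult_add_less_mult:
  fixes i a k m :: nat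
  assumes "i < a" "k < m"
  shows "i * m + k < a * m"
proof -
  have "i * m + k < Suc i * m" using assms by simp
  also have "\<dots> \<le> a * m" using assms by (intro mult_le_mono1) simp
  finally show ?thesis .
qed

text \<open>Cuts an initial segment into \<open>i\<close> full runs of length \<open>m\<close> and a
  remainder of length \<open>k\<close>. It serves row and column indices alike; \<open>k = 0\<close>
  gives the version for sums over a whole row or column.\<close>

lemma sum_lessThan_mult_add:
  fixes f :: "nat \<Rightarrow> 'a::comm_monoid_add"
  shows "(\<Sum>x<i * m + k. f x) = (\<Sum>i'<i. \<Sum>k'<m. f (i' * m + k')) + (\<Sum>k'<k. f (i * m + k'))"
proof -
  have shift: "sum f {c..<c + d} = (\<Sum>k'<d. f (c + k'))" for c d
    using sum.shift_bounds_nat_ivl[of f 0 c d] by (simp add: atLeast0LessThan add.commute)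
  have "(\<Sum>x<i * m + k. f x) = sum f {..<i * m} + sum f {i * m..<i * m + k}"
    by (metis add.commute atLeast0LessThan le_add1 sum.atLeastLessThan_concat zero_le)
  also have "sum f {..<i * m} = (\<Sum>i'<i. \<Sum>k'<m. f (i' * m + k'))"
    by (simp add: sum.nat_group[symmetric] shift)
  finally show ?thesis by (simp add: shift)
qed

lemmas sum_lessThan_mult = sum_lessThan_mult_add[where k = 0, simplified]

text \<open>The corner region splits into four pieces: whole blocks, blocks of block column
  \<open>j\<close> cut after \<open>l\<close> columns, blocks of block row \<open>i\<close> cut
  after \<open>k\<close> rows, and a corner of block \<open>(i, j)\<close>. If \<open>i = a\<close>
  or \<open>j = b\<close>, the bounds make the pieces that lie outside the grid empty sums.\<close>

lemma corner_sum_block_mat: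
  assumes "k \<le> m" "l \<le> n" "i * m + k \<le> a * m" "j * n + l \<le> b * n"
  shows "corner_sum (block_mat a b m n B) (i * m + k) (j * n + l) =
    (\<Sum>i'<i. \<Sum>j'<j. corner_sum (B (i', j')) m n) + (\<Sum>i'<i. corner_sum (B (i', j)) m l) +
    (\<Sum>j'<j. corner_sum (B (i, j')) k n) + corner_sum (B (i, j)) k l"
proof -
  define M where "M = block_mat a b m n B"
  have less1: "i' * m + k' < a * m" if "i' < i" "k' < m" for i' k'
    using mult_add_less_mult[OF that] assms(3) by linarith
  have less2: "j' * n + l' < b * n" if "j' < j" "l' < n" for j' l'
    using mult_add_less_mult[OF that] assms(4) by linarith
  have row: "(\<Sum>y<j * n + l. M $$ (i' * m + k', y)) =
      (\<Sum>j'<j. \<Sum>l'<n. B (i', j') $$ (k', l')) + (\<Sum>l'<l. B (i', j) $$ (k', l'))"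
    if "k' < m" "i' * m + k' < a * m" for i' k'
    unfolding sum_lessThan_mult_add M_def using that less2 assms
    by (auto intro!: arg_cong2[where f = "(+)"] sum.cong block_mat_index)
  have "corner_sum M (i * m + k) (j * n + l) =
     (\<Sum>i'<i. \<Sum>k'<m. (\<Sum>j'<j. \<Sum>l'<n. B (i', j') $$ (k', l')) + (\<Sum>l'<l. B (i', j) $$ (k', l'))) +
     (\<Sum>k'<k. (\<Sum>j'<j. \<Sum>l'<n. B (i, j') $$ (k', l')) + (\<Sum>l'<l. B (i, j) $$ (k', l')))"
    unfolding corner_sum_def sum_lessThan_mult_add[of _ i] using less1 assms
    by (auto intro!: arg_cong2[where f = "(+)"] sum.cong row)
  \<comment> \<open>Exchanging the block column index with the row index inside a block regroups the
    row-wise sums by blocks.\<close>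
  also have "\<dots> = (\<Sum>i'<i. \<Sum>j'<j. corner_sum (B (i', j')) m n) +
      (\<Sum>i'<i. corner_sum (B (i', j)) m l) +
      (\<Sum>j'<j. corner_sum (B (i, j')) k n) + corner_sum (B (i, j)) k l"
    by (simp add: corner_sum_def sum.distrib sum.swap[of _ "{..<j}" "{..<m}"]
        sum.swap[of _ "{..<j}" "{..<k}"])
  finally show ?thesis by (simp add: M_def)
qed

text \<open>A corner spanning all columns only sees complete rows, so its sum is the same for every
  member of the class. This and its transpose below make the contribution of an uncut or once-cut
  block independent of the block chosen.\<close>

lemma corner_sum_all_columns:
  assumes "A \<in> margin_class R S" "k \<le> dim_vec R"
  shows "corner_sum A k (dim_vec S) = (\<Sum>i<k. R $ i)"
  using assms by (auto simp: corner_sum_def margin_class_def intro!: sum.cong)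

lemma corner_sum_all_rows:
  assumes "A \<in> margin_class R S" "l \<le> dim_vec S"
  shows "corner_sum A (dim_vec R) l = (\<Sum>j<l. S $ j)"
  unfolding corner_sum_def sum.swap[of _ "{..<l}"]
  using assms by (auto simp: margin_class_def intro!: sum.cong)

lemma not_bruhat_leE:
  assumes "\<not> bruhat_le A C"
  obtains i j where "1 \<le> i" "i \<le> dim_row A" "1 \<le> j" "j \<le> dim_col A"
    "corner_sum A i j < corner_sum C i j"
  using assms by (auto simp: bruhat_le_def not_le)

section \<open>Finiteness of a class and counting its ones and zeros\<close>

text \<open>There are only finitely many 0-1 functions on the index grid, and a member is determined
  by its restriction to that grid. Hence the antichains are finite, which the cardinality
  computation requires.\<close>

lemma finite_margin_class: "finite (margin_class R S)"
proof -
  let ?I = "{..<dim_vec R} \<times> {..<dim_vec S}"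
  have "inj_on (\<lambda>A. restrict (\<lambda>x. A $$ x) ?I) (margin_class R S)"
  proof (rule inj_onI)
    fix A C
    assume A: "A \<in> margin_class R S" and C: "C \<in> margin_class R S"
      and eq: "restrict (\<lambda>x. A $$ x) ?I = restrict (\<lambda>x. C $$ x) ?I"
    show "A = C"
    proof (rule eq_matI)
      fix i j assume "i < dim_row C" "j < dim_col C"
      then have "(i, j) \<in> ?I" using C by (auto simp: margin_class_def)
      then show "A $$ (i, j) = C $$ (i, j)" using fun_cong[OF eq, of "(i, j)"] by simp
    qed (use A C in \<open>auto simp: margin_class_def\<close>)
  qed
  moreover have "(\<lambda>A. restrict (\<lambda>x. A $$ x) ?I) ` margin_class R S \<subseteq> ?I \<rightarrow>\<^sub>E {0, 1}"
    by (intro image_subsetI) (auto simp: margin_class_def restrict_PiE_iff)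
  moreover have "finite (?I \<rightarrow>\<^sub>E {0, 1::int})"
    by (intro finite_PiE) auto
  ultimately show ?thesis
    using finite_imageD finite_subset by blast
qed

text \<open>Source of the exponents: the row sums add up to the number of ones, so every member of
  the class has equally many ones, and equally many zeros.\<close>

lemma prod_if_margin_class:
  fixes x y :: nat
  assumes "A \<in> margin_class R S"
  shows "(\<Prod>p\<in>{..<dim_vec R} \<times> {..<dim_vec S}. if A $$ p = 1 then x else y) =
    x ^ nat (\<Sum>i<dim_vec R. R $ i) *
    y ^ nat (int (dim_vec R * dim_vec S) - (\<Sum>i<dim_vec R. R $ i))"
proof -
  let ?I = "{..<dim_vec R} \<times> {..<dim_vec S}"
  let ?J = "{p \<in> ?I. A $$ p = 1}"
  have "(\<Sum>i<dim_vec R. R $ i) = (\<Sum>p\<in>?I. A $$ p)"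
    using corner_sum_all_columns[OF assms order_refl]
    by (simp add: corner_sum_def sum.cartesian_product)
  also have "\<dots> = (\<Sum>p\<in>?I. if A $$ p = 1 then 1 else 0)"
    using assms by (intro sum.cong) (auto simp: margin_class_def)
  also have "\<dots> = int (card ?J)"
    by (simp add: sum.If_cases Int_def)
  finally have ones: "(\<Sum>i<dim_vec R. R $ i) = int (card ?J)" .
  have "card {p \<in> ?I. A $$ p \<noteq> 1} = card (?I - ?J)"
    by (rule arg_cong[where f = card]) auto
  also have "\<dots> = dim_vec R * dim_vec S - card ?J"
    by (subst card_Diff_subset) (auto simp: card_cartesian_product)
  also have "\<dots> = nat (int (dim_vec R * dim_vec S) - int (card ?J))"
    by (simp add: nat_diff_distrib' del: of_nat_mult)
  finally have zeros: "card {p \<in> ?I. A $$ p \<noteq> 1} = \<dots>" .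
  have "(\<Prod>p\<in>?I. if A $$ p = 1 then x else y) = x ^ card ?J * y ^ card {p \<in> ?I. A $$ p \<noteq> 1}"
    by (simp add: prod.If_cases Int_def)
  then show ?thesis
    unfolding ones zeros by simp
qed

text \<open>For \<open>f i\<close> in {0, 1} the conditional equals the linear expression
  \<open>f i * x + (1 - f i) * y\<close>. This produces the two Kronecker terms of the margins, one
  with the complemented vector.\<close>

lemma sum_if_zero_one:
  fixes x y :: int
  assumes "\<forall>i\<in>I. f i \<in> {0, 1}" "finite I"
  shows "(\<Sum>i\<in>I. if f i = 1 then x else y) = sum f I * x + (int (card I) - sum f I) * y"
proof -
  have "(\<Sum>i\<in>I. if f i = 1 then x else y) = (\<Sum>i\<in>I. f i * x + (1 - f i) * y)"
    using assms by (intro sum.cong) auto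
  then show ?thesis
    by (simp add: sum.distrib sum_subtractf flip: sum_distrib_right)
qed

section \<open>Admissible block families and the margins of the composite\<close>

text \<open>The product is extensional, so distinct families differ at some grid position and the
  number of families is a product of cardinalities.\<close>

definition block_families :: "int mat set \<Rightarrow> int mat set \<Rightarrow> int mat \<Rightarrow> (nat \<times> nat \<Rightarrow> int mat) set" where
  "block_families D2 D3 A =
     (\<Pi>\<^sub>E p\<in>{..<dim_row A} \<times> {..<dim_col A}. if A $$ p = 1 then D2 else D3)"

lemma block_familiesD:
  assumes "B \<in> block_families D2 D3 A" "i < dim_row A" "j < dim_col A"
  shows "B (i, j) \<in> (if A $$ (i, j) = 1 then D2 else D3)"
  using PiE_mem[OF assms(1)[unfolded block_families_def], of "(i, j)"] assms(2,3) by simp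

text \<open>Row \<open>i * m + k\<close> crosses \<open>R1 $ i\<close> blocks whose row
  \<open>k\<close> sums to \<open>R2 $ k\<close>, and \<open>b - R1 $ i\<close> blocks where it sums
  to \<open>R3 $ k\<close>. Columns behave in the same way.\<close>

lemma block_mat_margin_class:
  assumes A: "A \<in> margin_class R1 S1"
    and B: "B \<in> block_families (margin_class R2 S2) (margin_class R3 S3) A"
    and dims: "dim_vec R1 = a" "dim_vec S1 = b" "dim_vec R2 = m" "dim_vec R3 = m"
      "dim_vec S2 = n" "dim_vec S3 = n"
  shows "block_mat a b m n B \<in> margin_class
    (kron_vec R1 R2 + kron_vec (const_minus_vec (int b) R1) R3)
    (kron_vec S1 S2 + kron_vec (const_minus_vec (int a) S1) S3)"
    (is "?M \<in> margin_class ?R ?S")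
proof -
  have Adim: "dim_row A = a" "dim_col A = b"
    using A dims by (auto simp: margin_class_def)
  have A01: "A $$ (i, j) \<in> {0, 1}" if "i < a" "j < b" for i j
    using A dims that by (auto simp: margin_class_def)
  have Brow: "(\<Sum>l<n. B (i, j) $$ (k, l)) = (if A $$ (i, j) = 1 then R2 $ k else R3 $ k)"
    and B01: "l < n \<Longrightarrow> B (i, j) $$ (k, l) \<in> {0, 1}"
    if "i < a" "j < b" "k < m" for i j k l
    using block_familiesD[OF B, of i j] Adim dims that
    by (auto simp: margin_class_def split: if_splits)
  have Bcol: "(\<Sum>k<m. B (i, j) $$ (k, l)) = (if A $$ (i, j) = 1 then S2 $ l else S3 $ l)"
    if "i < a" "j < b" "l < n" for i j l
    using block_familiesD[OF B, of i j] Adim dims that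
    by (auto simp: margin_class_def split: if_splits)
  have dimR: "dim_vec ?R = a * m" and dimS: "dim_vec ?S = b * n"
    using dims by (simp_all add: kron_vec_def const_minus_vec_def)
  \<comment> \<open>\<open>x < c * d\<close> forces \<open>d > 0\<close>, so the remainder is a
    proper index.\<close>
  have split: "x div d < c \<and> x mod d < d \<and> x div d * d + x mod d = x" if "x < c * d" for x c d :: nat
    using that by (metis div_mult_mod_eq less_mult_imp_div_less mod_less_divisor mult_0_right
        neq0_conv not_less_zero)
  have entry: "?M $$ (x, y) = B (x div m, y div n) $$ (x mod m, y mod n)"
    if "x < a * m" "y < b * n" for x y
    using that by (simp add: block_mat_def)
  have "?M $$ (x, y) \<in> {0, 1}" if "x < a * m" "y < b * n" for x y
    unfolding entry[OF that] using split[OF that(1)] split[OF that(2)] by (intro B01) auto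
  moreover have "(\<Sum>y<b * n. ?M $$ (x, y)) = ?R $ x" if x: "x < a * m" for x
  proof -
    define i k where "i = x div m" and "k = x mod m"
    have ik: "i < a" "k < m" using split[OF x] by (auto simp: i_def k_def)
    have "(\<Sum>y<b * n. ?M $$ (x, y)) = (\<Sum>j<b. \<Sum>l<n. B (i, j) $$ (k, l))"
      unfolding sum_lessThan_mult
      by (intro sum.cong refl) (use x in \<open>auto simp: entry mult_add_less_mult i_def k_def\<close>)
    also have "\<dots> = (\<Sum>j<b. if A $$ (i, j) = 1 then R2 $ k else R3 $ k)"
      using ik by (intro sum.cong refl Brow) auto
    also have "\<dots> = R1 $ i * R2 $ k + (int b - R1 $ i) * R3 $ k"
      using A dims ik A01 by (subst sum_if_zero_one) (auto simp: margin_class_def)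
    also have "\<dots> = ?R $ x"
      using x ik dims by (simp add: kron_vec_def const_minus_vec_def i_def k_def)
    finally show ?thesis .
  qed
  moreover have "(\<Sum>x<a * m. ?M $$ (x, y)) = ?S $ y" if y: "y < b * n" for y
  proof -
    define j l where "j = y div n" and "l = y mod n"
    have jl: "j < b" "l < n" using split[OF y] by (auto simp: j_def l_def)
    have "(\<Sum>x<a * m. ?M $$ (x, y)) = (\<Sum>i<a. \<Sum>k<m. B (i, j) $$ (k, l))"
      unfolding sum_lessThan_mult
      by (intro sum.cong refl) (use y in \<open>auto simp: entry mult_add_less_mult j_def l_def\<close>)
    also have "\<dots> = (\<Sum>i<a. if A $$ (i, j) = 1 then S2 $ l else S3 $ l)"
      using jl by (intro sum.cong refl Bcol) auto
    also have "\<dots> = S1 $ j * S2 $ l + (int a - S1 $ j) * S3 $ l"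
      using A dims jl A01 by (subst sum_if_zero_one) (auto simp: margin_class_def)
    also have "\<dots> = ?S $ y"
      using y jl dims by (simp add: kron_vec_def const_minus_vec_def j_def l_def)
    finally show ?thesis .
  qed
  ultimately show ?thesis
    unfolding margin_class_def dimR dimS by auto
qed

section \<open>Incomparability of composites\<close>

text \<open>A negative slope reverses the comparison of corner sums, so even this one-sided
  conclusion draws on both directions of incomparability of \<open>A\<close> and
  \<open>A'\<close>.\<close>

lemma block_mat_not_bruhat_le_outer:
  assumes A: "A \<in> margin_class R1 S1" and A': "A' \<in> margin_class R1 S1"
    and B: "B \<in> block_families (margin_class R2 S2) (margin_class R3 S3) A"
    and B': "B' \<in> block_families (margin_class R2 S2) (margin_class R3 S3) A'"
    and dims: "dim_vec R1 = a" "dim_vec S1 = b" "dim_vec R2 = m" "dim_vec R3 = m"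
      "dim_vec S2 = n" "dim_vec S3 = n"
    and pos: "0 < m" "0 < n"
    and ne: "(\<Sum>i<m. R2 $ i) \<noteq> (\<Sum>i<m. R3 $ i)"
    and incomparable: "\<not> bruhat_le A A'" "\<not> bruhat_le A' A"
  shows "\<not> bruhat_le (block_mat a b m n B) (block_mat a b m n B')"
proof -
  let ?u' = "\<Sum>i<m. R2 $ i" and ?u'' = "\<Sum>i<m. R3 $ i"
  have cs: "corner_sum (block_mat a b m n C) (i * m) (j * n) =
      (?u' - ?u'') * corner_sum X i j + int (i * j) * ?u''"
    if X: "X \<in> margin_class R1 S1"
      and C: "C \<in> block_families (margin_class R2 S2) (margin_class R3 S3) X"
      and ij: "i \<le> a" "j \<le> b" for X C i j
  proof -
    have Xdim: "dim_row X = a" "dim_col X = b"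
      using X dims by (auto simp: margin_class_def)
    \<comment> \<open>The total of a block is \<open>u'\<close> or \<open>u''\<close> according to
      the outer entry, here written as an affine function of that entry.\<close>
    have *: "corner_sum (C (i', j')) m n = (?u' - ?u'') * X $$ (i', j') + ?u''"
      if "i' < a" "j' < b" for i' j'
    proof -
      have "X $$ (i', j') \<in> {0, 1}" using X dims that by (auto simp: margin_class_def)
      then show ?thesis
        using block_familiesD[OF C, of i' j'] Xdim that dims
          corner_sum_all_columns[of "C (i', j')" R2 S2 m]
          corner_sum_all_columns[of "C (i', j')" R3 S3 m]
        by (auto split: if_splits)
    qed
    \<comment> \<open>With \<open>k = l = 0\<close> the three pieces made of cut blocks
      vanish.\<close>
    have "corner_sum (block_mat a b m n C) (i * m) (j * n) =
        (\<Sum>i'<i. \<Sum>j'<j. corner_sum (C (i', j')) m n)"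
      using corner_sum_block_mat[of 0 m 0 n i a j b C] ij by (simp add: corner_sum_def)
    also have "\<dots> = (\<Sum>i'<i. \<Sum>j'<j. (?u' - ?u'') * X $$ (i', j') + ?u'')"
      using ij by (intro sum.cong refl *) auto
    also have "\<dots> = (?u' - ?u'') * corner_sum X i j + int (i * j) * ?u''"
      by (simp add: sum.distrib corner_sum_def flip: sum_distrib_left)
    finally show ?thesis .
  qed
  have Adim: "dim_row A = a" "dim_col A = b" "dim_row A' = a" "dim_col A' = b"
    using A A' dims by (auto simp: margin_class_def)
  \<comment> \<open>The sign of the slope selects the violated comparison: \<open>A\<close> against
    \<open>A'\<close> if positive, \<open>A'\<close> against \<open>A\<close> if negative.\<close>
  obtain i j where ij: "1 \<le> i" "i \<le> a" "1 \<le> j" "j \<le> b"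
    and less: "(?u' - ?u'') * corner_sum A i j < (?u' - ?u'') * corner_sum A' i j"
  proof (cases "?u' > ?u''")
    case True
    then show ?thesis
      using not_bruhat_leE[OF incomparable(1)] that Adim
      by (metis diff_gt_0_iff_gt mult_strict_left_mono)
  next
    case False
    then show ?thesis
      using not_bruhat_leE[OF incomparable(2)] that Adim ne
      by (metis diff_less_0_iff_less linorder_neqE mult_strict_left_mono_neg)
  qed
  then have "corner_sum (block_mat a b m n B) (i * m) (j * n)
      < corner_sum (block_mat a b m n B') (i * m) (j * n)"
    by (simp add: cs[OF A B] cs[OF A' B'])
  \<comment> \<open>Block corners are legitimate test positions: counts start at 1, and
    \<open>i\<close>, \<open>j\<close>, \<open>m\<close>, \<open>n\<close> are all positive.\<close>
  moreover have "i * m \<in> {1..a * m}" "j * n \<in> {1..b * n}"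
    using ij pos by (auto simp: Suc_le_eq)
  ultimately show ?thesis
    unfolding bruhat_le_def dim_block_mat by (meson not_le)
qed

text \<open>With a common outer matrix, \<open>B p\<close> and \<open>B' p\<close> lie in the same
  class at every grid position. So three of the four pieces in \<open>corner_sum_block_mat\<close>
  agree, and a single violation inside block \<open>(i, j)\<close> survives, however the other
  blocks compare.\<close>

lemma block_mat_not_bruhat_le_inner:
  assumes A: "A \<in> margin_class R1 S1"
    and B: "B \<in> block_families (margin_class R2 S2) (margin_class R3 S3) A"
    and B': "B' \<in> block_families (margin_class R2 S2) (margin_class R3 S3) A"
    and dims: "dim_vec R1 = a" "dim_vec S1 = b" "dim_vec R2 = m" "dim_vec R3 = m"
      "dim_vec S2 = n" "dim_vec S3 = n"
    and ij: "i < a" "j < b" and incomparable: "\<not> bruhat_le (B (i, j)) (B' (i, j))"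
  shows "\<not> bruhat_le (block_mat a b m n B) (block_mat a b m n B')"
proof -
  have Adim: "dim_row A = a" "dim_col A = b"
    using A dims by (auto simp: margin_class_def)
  have mem: "B p \<in> margin_class R2 S2 \<and> B' p \<in> margin_class R2 S2 \<or>
      B p \<in> margin_class R3 S3 \<and> B' p \<in> margin_class R3 S3"
    if "p \<in> {..<a} \<times> {..<b}" for p
    using block_familiesD[OF B, of "fst p" "snd p"] block_familiesD[OF B', of "fst p" "snd p"]
      Adim that by (auto split: if_splits)
  have rows: "corner_sum (B p) k n = corner_sum (B' p) k n"
    if "p \<in> {..<a} \<times> {..<b}" "k \<le> m" for p k
    using mem[OF that(1)] that(2) dims corner_sum_all_columns by metis
  have cols: "corner_sum (B p) m l = corner_sum (B' p) m l"
    if "p \<in> {..<a} \<times> {..<b}" "l \<le> n" for p l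
    using mem[OF that(1)] that(2) dims corner_sum_all_rows by metis
  have "dim_row (B (i, j)) = m" "dim_col (B (i, j)) = n"
    using mem[of "(i, j)"] ij dims by (auto simp: margin_class_def)
  then obtain k l where kl: "1 \<le> k" "k \<le> m" "1 \<le> l" "l \<le> n"
    and less: "corner_sum (B (i, j)) k l < corner_sum (B' (i, j)) k l"
    using not_bruhat_leE[OF incomparable] by metis
  \<comment> \<open>\<open>k\<close> and \<open>l\<close> are counts that may equal \<open>m\<close>
    and \<open>n\<close>; the strict bound is applied to the last indices \<open>k - 1\<close> and
    \<open>l - 1\<close>.\<close>
  have ineq: "i * m + k \<le> a * m" "j * n + l \<le> b * n"
    using mult_add_less_mult[of i a "k - 1" m] mult_add_less_mult[of j b "l - 1" n] ij kl
    by linarith+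
  have "(\<Sum>i'<i. \<Sum>j'<j. corner_sum (B (i', j')) m n) = (\<Sum>i'<i. \<Sum>j'<j. corner_sum (B' (i', j')) m n)"
    "(\<Sum>i'<i. corner_sum (B (i', j)) m l) = (\<Sum>i'<i. corner_sum (B' (i', j)) m l)"
    "(\<Sum>j'<j. corner_sum (B (i, j')) k n) = (\<Sum>j'<j. corner_sum (B' (i, j')) k n)"
    using ij kl by (auto intro!: sum.cong rows cols)
  then have "corner_sum (block_mat a b m n B) (i * m + k) (j * n + l)
      < corner_sum (block_mat a b m n B') (i * m + k) (j * n + l)"
    using less kl ineq by (simp add: corner_sum_block_mat)
  moreover have "i * m + k \<in> {1..a * m}" "j * n + l \<in> {1..b * n}"
    using ineq kl by auto
  ultimately show ?thesis
    unfolding bruhat_le_def dim_block_mat by (meson not_le)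
qed

section \<open>The antichain and its cardinality\<close>

theorem theorem6:
  fixes a b m n :: nat
    and R1 R2 R3 S1 S2 S3 R S :: "int vec"
    and u u' u'' :: int
    and D1 D2 D3 :: "int mat set"
  assumes "0 < a" and "0 < b" and "0 < m" and "0 < n"
    and "R1 \<in> carrier_vec a" and "R2 \<in> carrier_vec m" and "R3 \<in> carrier_vec m"
    and "S1 \<in> carrier_vec b" and "S2 \<in> carrier_vec n" and "S3 \<in> carrier_vec n"
    and "\<forall>i<a. 0 \<le> R1 $ i" and "\<forall>i<m. 0 \<le> R2 $ i" and "\<forall>i<m. 0 \<le> R3 $ i"
    and "\<forall>j<b. 0 \<le> S1 $ j" and "\<forall>j<n. 0 \<le> S2 $ j" and "\<forall>j<n. 0 \<le> S3 $ j"
    and "u = (\<Sum>i<a. R1 $ i)" and "u' = (\<Sum>i<m. R2 $ i)" and "u'' = (\<Sum>i<m. R3 $ i)"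
    and "u' \<noteq> u''"
    and "bruhat_antichain R1 S1 D1" and "bruhat_antichain R2 S2 D2"
    and "bruhat_antichain R3 S3 D3"
    and "R = kron_vec R1 R2 + kron_vec (const_minus_vec (int b) R1) R3"
    and "S = kron_vec S1 S2 + kron_vec (const_minus_vec (int a) S1) S3"
  shows "\<exists>D. bruhat_antichain R S D \<and>
    card D = card D1 * card D2 ^ nat u * card D3 ^ nat (int (a * b) - u)"
proof -
  have dims: "dim_vec R1 = a" "dim_vec S1 = b" "dim_vec R2 = m" "dim_vec R3 = m"
      "dim_vec S2 = n" "dim_vec S3 = n"
    using assms by auto
  have D: "D1 \<subseteq> margin_class R1 S1" "D2 \<subseteq> margin_class R2 S2" "D3 \<subseteq> margin_class R3 S3"
    and anti1: "A \<in> D1 \<Longrightarrow> C \<in> D1 \<Longrightarrow> A \<noteq> C \<Longrightarrow> \<not> bruhat_le A C"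
    and anti2: "A \<in> D2 \<Longrightarrow> C \<in> D2 \<Longrightarrow> A \<noteq> C \<Longrightarrow> \<not> bruhat_le A C"
    and anti3: "A \<in> D3 \<Longrightarrow> C \<in> D3 \<Longrightarrow> A \<noteq> C \<Longrightarrow> \<not> bruhat_le A C" for A C
    using assms(21-23) by (auto simp: bruhat_antichain_def)
  have fin: "finite D1" "finite D2" "finite D3"
    using D finite_margin_class finite_subset by blast+
  have dimA: "dim_row A = a" "dim_col A = b" if "A \<in> D1" for A
    using D(1) that dims by (auto simp: margin_class_def)
  \<comment> \<open>A dependent sum, because the admissible families depend on the outer
    matrix.\<close>
  define P where "P = (SIGMA A:D1. block_families D2 D3 A)"
  define f where "f = (\<lambda>(A :: int mat, B). block_mat a b m n B)"
  have families: "block_families D2 D3 A \<subseteq>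
      block_families (margin_class R2 S2) (margin_class R3 S3) A" for A
    unfolding block_families_def using D(2,3) by (intro PiE_mono) auto
  \<comment> \<open>Ranging over ordered pairs, this covers both directions of
    incomparability.\<close>
  have not_le: "\<not> bruhat_le (f p) (f q)" if p: "p \<in> P" and q: "q \<in> P" and "p \<noteq> q" for p q
  proof -
    obtain A B A' B' where pq: "p = (A, B)" "q = (A', B')" by (metis surj_pair)
    have A: "A \<in> D1" "A' \<in> D1" and B: "B \<in> block_families D2 D3 A" "B' \<in> block_families D2 D3 A'"
      using p q by (auto simp: P_def pq)
    show ?thesis
    proof (cases "A = A'")
      case False
      have "\<not> bruhat_le (block_mat a b m n B) (block_mat a b m n B')"
        using A B D(1) families anti1 False assms(3,4,18-20)
        by (intro block_mat_not_bruhat_le_outer[OF _ _ _ _ dims, of A A']) auto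
      then show ?thesis by (simp add: f_def pq)
    next
      case True
      then have "B \<noteq> B'" using \<open>p \<noteq> q\<close> pq by simp
      then obtain x where "x \<in> {..<a} \<times> {..<b}" "B x \<noteq> B' x"
        using B True dimA[OF A(1)] unfolding block_families_def by (metis PiE_ext)
      then obtain i j where ij: "i < a" "j < b" "B (i, j) \<noteq> B' (i, j)"
        by auto
      have "\<not> bruhat_le (B (i, j)) (B' (i, j))"
        using block_familiesD[OF B(1), of i j] block_familiesD[OF B(2), of i j] True ij
          dimA[OF A(1)] anti2 anti3 by (auto split: if_splits)
      then have "\<not> bruhat_le (block_mat a b m n B) (block_mat a b m n B')"
        using A B D(1) families True ij
        by (intro block_mat_not_bruhat_le_inner[OF _ _ _ dims, of A]) auto
      then show ?thesis by (simp add: f_def pq)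
    qed
  qed
  \<comment> \<open>By reflexivity, two distinct pairs with the same image would contradict
    \<open>not_le\<close>; so incomparability also yields injectivity.\<close>
  have "bruhat_le X X" for X by (simp add: bruhat_le_def)
  then have inj: "inj_on f P"
    using not_le by (metis inj_onI)
  have "f ` P \<subseteq> margin_class R S"
    using block_mat_margin_class[OF _ _ dims] D(1) families
    unfolding assms(24,25) by (fastforce simp: P_def f_def)
  then have "bruhat_antichain R S (f ` P)"
    unfolding bruhat_antichain_def using not_le by blast
  moreover have "card (f ` P) = card D1 * card D2 ^ nat u * card D3 ^ nat (int (a * b) - u)"
  proof -
    \<comment> \<open>The count is the same for all \<open>A\<close> in \<open>D1\<close>, since
      each has exactly \<open>u\<close> ones; summing it over \<open>D1\<close> gives the factor
      \<open>card D1\<close>.\<close>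
    have families_card: "card (block_families D2 D3 A) =
        card D2 ^ nat u * card D3 ^ nat (int (a * b) - u)" if "A \<in> D1" for A
    proof -
      have "card (block_families D2 D3 A) =
          (\<Prod>p\<in>{..<a} \<times> {..<b}. if A $$ p = 1 then card D2 else card D3)"
        unfolding block_families_def dimA[OF that] by (simp add: card_PiE if_distrib)
      then show ?thesis
        using prod_if_margin_class[of A R1 S1] that D(1) dims assms(17) by auto
    qed
    have "finite (block_families D2 D3 A)" for A
      unfolding block_families_def using fin by (intro finite_PiE) auto
    then have "card P = (\<Sum>A\<in>D1. card (block_families D2 D3 A))"
      unfolding P_def using fin by (intro card_SigmaI) auto
    then show ?thesis
      by (simp add: card_image[OF inj] families_card)
  qed
  ultimately show ?thesis by blast
qed

end
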